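(* Let $n\ge2$. In the polycyclic monoid $P_n$ on $n$ generators we have: (1) for all $a,b,c\in P_n$ with $b\ne0$, if $a\sim_p b$ and $b\sim_p c$, then $a\sim_p c$; (2) $\sim_p\circ\sim_p\;=\;\sim_p^*$.
   Context: For elements $a,b$ of a monoid $M$, $a\sim_p b$ means that there exist $u,v\in M$ with $a=uv$ and $b=vu$. $\sim_p^*$ denotes the transitive closure of $\sim_p$, and $\circ$ denotes composition of binary relations. Polycyclic monoid: let $n\ge2$, $A_n=\{p_1,\dots,p_n\}$, $A_n^{-1}=\{p_1^{-1},\dots,p_n^{-1}\}$ a disjoint copy, $\Sigma=A_n\cup A_n^{-1}$, $\Sigma_0=\Sigma\cup\{0\}$. $P_n$ is the monoid generated by $\Sigma_0$ with defining relations $p_i^{-1}p_i=1$, $p_i^{-1}p_j=0$ for $i\ne j$, and $x0=0$, $0x=0$, $00=0$ for $x\in\Sigma$. The element $0$ is the zero of $P_n$. *)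

theory Defs
  imports "HOL-Algebra.Group"
begin

text \<open>The congruence on the free monoid \<open>lists X\<close> generated by a set \<open>R\<close> of relations;
  relations involving words that are not over \<open>X\<close> are ignored.\<close>

inductive_set pres_cong :: "'a set \<Rightarrow> ('a list \<times> 'a list) set \<Rightarrow> ('a list \<times> 'a list) set"
  for X :: "'a set" and R :: "('a list \<times> 'a list) set" where
  base: "(u, v) \<in> R \<Longrightarrow> u \<in> lists X \<Longrightarrow> v \<in> lists X \<Longrightarrow> (u, v) \<in> pres_cong X R"
| refl: "u \<in> lists X \<Longrightarrow> (u, u) \<in> pres_cong X R"
| sym: "(u, v) \<in> pres_cong X R \<Longrightarrow> (v, u) \<in> pres_cong X R"
| trans: "(u, v) \<in> pres_cong X R \<Longrightarrow> (v, w) \<in> pres_cong X R \<Longrightarrow> (u, w) \<in> pres_cong X R"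
| append: "(u, v) \<in> pres_cong X R \<Longrightarrow> (u', v') \<in> pres_cong X R
    \<Longrightarrow> (u @ u', v @ v') \<in> pres_cong X R"

definition pres_class :: "'a set \<Rightarrow> ('a list \<times> 'a list) set \<Rightarrow> 'a list \<Rightarrow> 'a list set" where
  "pres_class X R w = pres_cong X R `` {w}"

definition presented_monoid :: "'a set \<Rightarrow> ('a list \<times> 'a list) set \<Rightarrow> 'a list set monoid" where
  "presented_monoid X R =
    \<lparr>carrier = lists X // pres_cong X R,
     mult = (\<lambda>A B. \<Union>u\<in>A. \<Union>v\<in>B. pres_class X R (u @ v)),
     one = pres_class X R []\<rparr>"

lemma pres_cong_words:
  assumes "(u, v) \<in> pres_cong X R"
  shows "u \<in> lists X \<and> v \<in> lists X"
  using assms by (induction rule: pres_cong.induct) auto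

lemma equiv_pres_cong: "equiv (lists X) (pres_cong X R)"
proof (rule equivI)
  show "pres_cong X R \<subseteq> lists X \<times> lists X"
    using pres_cong_words by fastforce
  show "refl_on (lists X) (pres_cong X R)"
    by (rule refl_onI) (rule pres_cong.refl)
  show "sym (pres_cong X R)"
    by (rule symI) (rule pres_cong.sym)
  show "trans (pres_cong X R)"
    by (rule transI) (rule pres_cong.trans)
qed

lemma pres_class_eq_iff:
  assumes "u \<in> lists X" "v \<in> lists X"
  shows "pres_class X R u = pres_class X R v \<longleftrightarrow> (u, v) \<in> pres_cong X R"
  unfolding pres_class_def
  using eq_equiv_class_iff[OF equiv_pres_cong assms] .

lemma carrier_presented_monoid:
  "carrier (presented_monoid X R) = pres_class X R ` lists X"
  by (auto simp: presented_monoid_def pres_class_def quotient_def)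

lemma one_presented_monoid: "\<one>\<^bsub>presented_monoid X R\<^esub> = pres_class X R []"
  by (simp add: presented_monoid_def)

lemma mult_presented_monoid:
  assumes u: "u \<in> lists X" and v: "v \<in> lists X"
  shows "pres_class X R u \<otimes>\<^bsub>presented_monoid X R\<^esub> pres_class X R v = pres_class X R (u @ v)"
proof -
  have *: "pres_class X R (u' @ v') = pres_class X R (u @ v)"
    if "u' \<in> pres_class X R u" "v' \<in> pres_class X R v" for u' v'
  proof -
    have c: "(u, u') \<in> pres_cong X R" "(v, v') \<in> pres_cong X R"
      using that by (auto simp: pres_class_def)
    then have "(u @ v, u' @ v') \<in> pres_cong X R"
      by (rule pres_cong.append)
    then show ?thesis
      using pres_cong_words[of "u @ v" "u' @ v'" X R] pres_class_eq_iff[of "u @ v" X "u' @ v'" R]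
      by blast
  qed
  have mem: "u \<in> pres_class X R u" "v \<in> pres_class X R v"
    unfolding pres_class_def using u v by (blast intro: pres_cong.refl)+
  have "(\<Union>u'\<in>pres_class X R u. \<Union>v'\<in>pres_class X R v. pres_class X R (u' @ v'))
      = (\<Union>u'\<in>pres_class X R u. \<Union>v'\<in>pres_class X R v. pres_class X R (u @ v))"
    by (intro SUP_cong HOL.refl *)
  also have "\<dots> = pres_class X R (u @ v)"
    using mem by blast
  finally show ?thesis
    by (simp add: presented_monoid_def)
qed

lemma monoid_presented_monoid: "monoid (presented_monoid X R)"
proof (rule monoidI)
  fix x y z
  assume "x \<in> carrier (presented_monoid X R)" "y \<in> carrier (presented_monoid X R)"
    "z \<in> carrier (presented_monoid X R)"
  then obtain u v w where "u \<in> lists X" "v \<in> lists X" "w \<in> lists X"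
      "x = pres_class X R u" "y = pres_class X R v" "z = pres_class X R w"
    unfolding carrier_presented_monoid by blast
  then show "x \<otimes>\<^bsub>presented_monoid X R\<^esub> y \<otimes>\<^bsub>presented_monoid X R\<^esub> z
      = x \<otimes>\<^bsub>presented_monoid X R\<^esub> (y \<otimes>\<^bsub>presented_monoid X R\<^esub> z)"
    by (simp add: mult_presented_monoid del: in_lists_conv_set)
next
  fix x y
  assume "x \<in> carrier (presented_monoid X R)" "y \<in> carrier (presented_monoid X R)"
  then obtain u v where "u \<in> lists X" "v \<in> lists X"
      "x = pres_class X R u" "y = pres_class X R v"
    unfolding carrier_presented_monoid by blast
  then show "x \<otimes>\<^bsub>presented_monoid X R\<^esub> y \<in> carrier (presented_monoid X R)"
    by (simp add: mult_presented_monoid carrier_presented_monoid del: in_lists_conv_set)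
next
  show "\<one>\<^bsub>presented_monoid X R\<^esub> \<in> carrier (presented_monoid X R)"
    by (simp add: one_presented_monoid carrier_presented_monoid)
next
  fix x
  assume "x \<in> carrier (presented_monoid X R)"
  then obtain u where u: "u \<in> lists X" "x = pres_class X R u"
    unfolding carrier_presented_monoid by blast
  then show "\<one>\<^bsub>presented_monoid X R\<^esub> \<otimes>\<^bsub>presented_monoid X R\<^esub> x = x"
    by (simp add: one_presented_monoid mult_presented_monoid del: in_lists_conv_set)
  show "x \<otimes>\<^bsub>presented_monoid X R\<^esub> \<one>\<^bsub>presented_monoid X R\<^esub> = x"
    using u by (simp add: one_presented_monoid mult_presented_monoid del: in_lists_conv_set)
qed

definition prim_conj :: "('a, 'b) monoid_scheme \<Rightarrow> ('a \<times> 'a) set" where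
  "prim_conj M =
    {(u \<otimes>\<^bsub>M\<^esub> v, v \<otimes>\<^bsub>M\<^esub> u) | u v. u \<in> carrier M \<and> v \<in> carrier M}"

text \<open>\<open>Gen i\<close>, \<open>InvGen i\<close> and \<open>ZeroGen\<close> stand for the symbols $p_i$, $p_i^{-1}$ and $0$.\<close>

datatype pc_letter = Gen nat | InvGen nat | ZeroGen

definition pc_sigma :: "nat \<Rightarrow> pc_letter set" where
  "pc_sigma n = Gen ` {1..n} \<union> InvGen ` {1..n}"

definition pc_sigma0 :: "nat \<Rightarrow> pc_letter set" where
  "pc_sigma0 n = insert ZeroGen (pc_sigma n)"

definition pc_rels :: "nat \<Rightarrow> (pc_letter list \<times> pc_letter list) set" where
  "pc_rels n =
     {([InvGen i, Gen i], []) | i. i \<in> {1..n}}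
   \<union> {([InvGen i, Gen j], [ZeroGen]) | i j. i \<in> {1..n} \<and> j \<in> {1..n} \<and> i \<noteq> j}
   \<union> {([x, ZeroGen], [ZeroGen]) | x. x \<in> pc_sigma n}
   \<union> {([ZeroGen, x], [ZeroGen]) | x. x \<in> pc_sigma n}
   \<union> {([ZeroGen, ZeroGen], [ZeroGen])}"

definition polycyclic :: "nat \<Rightarrow> pc_letter list set monoid" where
  "polycyclic n = presented_monoid (pc_sigma0 n) (pc_rels n)"

definition pc_zero :: "nat \<Rightarrow> pc_letter list set" where
  "pc_zero n = pres_class (pc_sigma0 n) (pc_rels n) [ZeroGen]"

end

theory Submission imports Defs
begin

text \<open>Every nonzero element of \<open>P\<^sub>n\<close> is uniquely of the form \<open>x y\<^sup>-\<^sup>1\<close> with words \<open>x, y\<close> over the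
  positive generators. Cancelling the longest common prefix of \<open>x\<close> and \<open>y\<close> leaves a pair
  \<open>(\<alpha>, \<beta>)\<close>. Two nonzero elements are primarily conjugate iff their pairs agree, or one component
  is empty in both pairs and the other components are rotations of each other. A nonzero element
  is primarily conjugate to \<open>0\<close> iff \<open>\<alpha>\<close> and \<open>\<beta>\<close> are both nonempty. Hence transitivity can only
  fail at \<open>0\<close>, and every chain can be shortened to at most two steps.\<close>

section \<open>Normal forms\<close>

text \<open>\<open>Some (x, y)\<close> stands for \<open>x y\<^sup>-\<^sup>1\<close> and \<open>None\<close> for \<open>0\<close>; \<open>y\<^sup>-\<^sup>1\<close> lists the inverses of the
  letters of \<open>y\<close> in reverse order.\<close>

type_synonym pc_nf = "(nat list \<times> nat list) option"

text \<open>Left multiplication of a normal form by one letter. Since y^-1 lists y backwards, an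
  inverse letter put in front of y^-1 is appended at the end of \<open>y\<close>.\<close>

fun pc_act :: "pc_letter \<Rightarrow> pc_nf \<Rightarrow> pc_nf" where
  "pc_act (Gen i) (Some (x, y)) = Some (i # x, y)"
| "pc_act (InvGen i) (Some ([], y)) = Some ([], y @ [i])"
| "pc_act (InvGen i) (Some (j # x, y)) = (if i = j then Some (x, y) else None)"
| "pc_act ZeroGen m = None"
| "pc_act l None = None"

lemma pc_act_None [simp]: "pc_act l None = None"
  by (cases l) auto

lemma foldr_pc_act_None [simp]: "foldr pc_act w None = None"
  by (induction w) auto

fun nf_word :: "pc_nf \<Rightarrow> pc_letter list" where
  "nf_word None = [ZeroGen]"
| "nf_word (Some (x, y)) = map Gen x @ map InvGen (rev y)"

definition nf_carrier :: "nat \<Rightarrow> pc_nf set" where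
  "nf_carrier n = insert None (Some ` (lists {1..n} \<times> lists {1..n}))"

lemma None_in_nf_carrier [simp]: "None \<in> nf_carrier n"
  by (simp add: nf_carrier_def)

lemma Some_in_nf_carrier [simp]:
  "Some (x, y) \<in> nf_carrier n \<longleftrightarrow> set x \<subseteq> {1..n} \<and> set y \<subseteq> {1..n}"
  by (auto simp: nf_carrier_def)

definition nf_mult :: "pc_nf \<Rightarrow> pc_nf \<Rightarrow> pc_nf" where
  "nf_mult a b = foldr pc_act (nf_word a) b"

definition nf_class :: "nat \<Rightarrow> pc_nf \<Rightarrow> pc_letter list set" where
  "nf_class n m = pres_class (pc_sigma0 n) (pc_rels n) (nf_word m)"

lemma foldr_map_Gen: "foldr pc_act (map Gen x) (Some (z, y)) = Some (x @ z, y)"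
  by (induction x) auto

lemma foldr_map_InvGen:
  "foldr pc_act (map InvGen (rev y)) (Some ([], z)) = Some ([], z @ y)"
  by (induction y arbitrary: z) auto

lemma foldr_nf_word: "foldr pc_act (nf_word m) (Some ([], [])) = m"
  by (cases m) (auto simp: foldr_map_Gen foldr_map_InvGen)

section \<open>Congruent words and their action on normal forms\<close>

lemma in_pc_sigma0_iff [simp]:
  "Gen i \<in> pc_sigma0 n \<longleftrightarrow> i \<in> {1..n}"
  "InvGen i \<in> pc_sigma0 n \<longleftrightarrow> i \<in> {1..n}"
  "ZeroGen \<in> pc_sigma0 n"
  by (auto simp: pc_sigma0_def pc_sigma_def)

text \<open>The two sides of each defining relation act alike, and this passes to the generated
  congruence. So the action of a word is an invariant of its class.\<close>

lemma pres_cong_foldr_pc_act: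
  "(u, v) \<in> pres_cong (pc_sigma0 n) (pc_rels n) \<Longrightarrow> foldr pc_act u m = foldr pc_act v m"
proof (induction arbitrary: m rule: pres_cong.induct)
  case (base u v)
  then show ?case
    by (cases m) (auto simp: pc_rels_def)
qed auto

lemma nf_word_in_lists: "m \<in> nf_carrier n \<Longrightarrow> nf_word m \<in> lists (pc_sigma0 n)"
  by (cases m rule: nf_word.cases) (auto simp: subset_iff)

lemma pc_act_in_nf_carrier:
  "l \<in> pc_sigma0 n \<Longrightarrow> m \<in> nf_carrier n \<Longrightarrow> pc_act l m \<in> nf_carrier n"
  by (cases "(l, m)" rule: pc_act.cases) auto

lemma foldr_pc_act_in_nf_carrier:
  "w \<in> lists (pc_sigma0 n) \<Longrightarrow> m \<in> nf_carrier n \<Longrightarrow> foldr pc_act w m \<in> nf_carrier n"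
  by (induction w) (auto intro: pc_act_in_nf_carrier)

lemma pres_cong_rewrite:
  assumes "(u, v) \<in> R" "u @ w \<in> lists X" "v \<in> lists X"
  shows "(u @ w, v @ w) \<in> pres_cong X R"
  using assms by (auto intro!: pres_cong.append pres_cong.base pres_cong.refl)

lemma pres_cong_zero_left:
  assumes "w \<in> lists (pc_sigma0 n)"
  shows "(ZeroGen # w, [ZeroGen]) \<in> pres_cong (pc_sigma0 n) (pc_rels n)"
  using assms
proof (induction w)
  case Nil
  then show ?case by (auto intro: pres_cong.refl simp: pc_sigma0_def)
next
  case (Cons l w)
  have "([ZeroGen, l] @ w, [ZeroGen] @ w) \<in> pres_cong (pc_sigma0 n) (pc_rels n)"
    using Cons.hyps by (intro pres_cong_rewrite) (auto simp: pc_rels_def pc_sigma0_def)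
  then show ?case
    using Cons.IH by (auto intro: pres_cong.trans)
qed

text \<open>Each clause of \<open>pc_act\<close> either leaves the word as it is or carries out a
  defining relation. A 0 that stands or arises in front absorbs the rest of the word.\<close>

lemma pc_act_cong:
  assumes "l \<in> pc_sigma0 n" "m \<in> nf_carrier n"
  shows "(l # nf_word m, nf_word (pc_act l m)) \<in> pres_cong (pc_sigma0 n) (pc_rels n)"
proof -
  have ws: "l # nf_word m \<in> lists (pc_sigma0 n)"
    using assms nf_word_in_lists by auto
  have refl: "(w, w) \<in> pres_cong (pc_sigma0 n) (pc_rels n)" if "w = l # nf_word m" for w
    using that ws by (blast intro: pres_cong.refl)
  have zero: "(ZeroGen # w, [ZeroGen]) \<in> pres_cong (pc_sigma0 n) (pc_rels n)"
    if "w \<in> lists (pc_sigma0 n)" for w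
    using that by (rule pres_cong_zero_left)
  have None: "(l # nf_word m, nf_word (pc_act l m)) \<in> pres_cong (pc_sigma0 n) (pc_rels n)"
    if "m = None" "l \<in> pc_sigma n"
  proof -
    have "([l, ZeroGen] @ [], [ZeroGen] @ []) \<in> pres_cong (pc_sigma0 n) (pc_rels n)"
      using that assms(1) by (intro pres_cong_rewrite) (auto simp: pc_rels_def)
    then show ?thesis using that by simp
  qed
  show ?thesis
  proof (cases "(l, m)" rule: pc_act.cases)
    case (1 i x y)
    then show ?thesis using refl by simp
  next
    case (2 i y)
    then show ?thesis using refl by simp
  next
    case (4 m')
    then show ?thesis using zero nf_word_in_lists[OF assms(2)] by simp
  next
    case ("5_1" i)
    then show ?thesis using None assms(1) by (auto simp: pc_sigma0_def)
  next
    case ("5_2" i)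
    then show ?thesis using None assms(1) by (auto simp: pc_sigma0_def)
  next
    case (3 i j x y)
    define w where "w = nf_word (Some (x, y))"
    have w: "[InvGen i, Gen j] @ w \<in> lists (pc_sigma0 n)"
      using ws 3 by (simp add: w_def)
    have ij: "i \<in> {1..n}" "j \<in> {1..n}"
      using assms 3 by auto
    show ?thesis
    proof (cases "i = j")
      case True
      have "([InvGen i, Gen j] @ w, [] @ w) \<in> pres_cong (pc_sigma0 n) (pc_rels n)"
        using w ij True by (intro pres_cong_rewrite) (auto simp: pc_rels_def)
      then show ?thesis using 3 True by (simp add: w_def)
    next
      case False
      have "([InvGen i, Gen j] @ w, [ZeroGen] @ w) \<in> pres_cong (pc_sigma0 n) (pc_rels n)"
        using w ij False by (intro pres_cong_rewrite) (auto simp: pc_rels_def)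
      moreover have "([ZeroGen] @ w, [ZeroGen]) \<in> pres_cong (pc_sigma0 n) (pc_rels n)"
        using zero w by simp
      ultimately have "([InvGen i, Gen j] @ w, [ZeroGen]) \<in> pres_cong (pc_sigma0 n) (pc_rels n)"
        by (rule pres_cong.trans)
      then show ?thesis using 3 False by (simp add: w_def)
    qed
  qed
qed

lemma foldr_pc_act_cong:
  assumes "w \<in> lists (pc_sigma0 n)" "m \<in> nf_carrier n"
  shows "(w @ nf_word m, nf_word (foldr pc_act w m)) \<in> pres_cong (pc_sigma0 n) (pc_rels n)"
  using assms(1)
proof (induction w)
  case Nil
  then show ?case using nf_word_in_lists[OF assms(2)] by (auto intro: pres_cong.refl)
next
  case (Cons l w)
  have "([l], [l]) \<in> pres_cong (pc_sigma0 n) (pc_rels n)"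
    using Cons.hyps by (intro pres_cong.refl) auto
  from pres_cong.append[OF this Cons.IH]
  have "(l # w @ nf_word m, l # nf_word (foldr pc_act w m)) \<in> pres_cong (pc_sigma0 n) (pc_rels n)"
    by simp
  moreover have "(l # nf_word (foldr pc_act w m), nf_word (pc_act l (foldr pc_act w m)))
      \<in> pres_cong (pc_sigma0 n) (pc_rels n)"
    using Cons.hyps assms(2) foldr_pc_act_in_nf_carrier by (intro pc_act_cong) auto
  ultimately show ?case by (auto intro: pres_cong.trans)
qed

section \<open>The polycyclic monoid as a monoid of normal forms\<close>

lemma carrier_polycyclic: "carrier (polycyclic n) = nf_class n ` nf_carrier n"
proof
  show "nf_class n ` nf_carrier n \<subseteq> carrier (polycyclic n)"
    using nf_word_in_lists by (auto simp: polycyclic_def carrier_presented_monoid nf_class_def)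
  show "carrier (polycyclic n) \<subseteq> nf_class n ` nf_carrier n"
  proof
    fix a assume "a \<in> carrier (polycyclic n)"
    then obtain w where w: "w \<in> lists (pc_sigma0 n)" "a = pres_class (pc_sigma0 n) (pc_rels n) w"
      by (auto simp: polycyclic_def carrier_presented_monoid)
    \<comment> \<open>\<open>Some ([], [])\<close> is the normal form of 1, represented by the empty
      word; letting \<open>w\<close> act on it evaluates \<open>w\<close>.\<close>
    define m where "m = foldr pc_act w (Some ([], []))"
    have m: "m \<in> nf_carrier n"
      unfolding m_def using w by (intro foldr_pc_act_in_nf_carrier) auto
    have "(w, nf_word m) \<in> pres_cong (pc_sigma0 n) (pc_rels n)"
      using foldr_pc_act_cong[OF w(1), of "Some ([], [])"] by (simp add: m_def)
    then have "a = nf_class n m"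
      using w m nf_word_in_lists by (auto simp: nf_class_def pres_class_eq_iff)
    then show "a \<in> nf_class n ` nf_carrier n" using m by blast
  qed
qed

text \<open>A normal form can be recovered from its class: \<open>nf_word m\<close> acting on 1
  returns \<open>m\<close>, and congruent words act alike.\<close>

lemma inj_on_nf_class: "inj_on (nf_class n) (nf_carrier n)"
proof (rule inj_onI)
  fix a b assume "a \<in> nf_carrier n" "b \<in> nf_carrier n" "nf_class n a = nf_class n b"
  then have "(nf_word a, nf_word b) \<in> pres_cong (pc_sigma0 n) (pc_rels n)"
    using nf_word_in_lists by (simp add: nf_class_def pres_class_eq_iff)
  from pres_cong_foldr_pc_act[OF this, of "Some ([], [])"] show "a = b"
    by (simp add: foldr_nf_word)
qed

lemma nf_mult_in_nf_carrier:
  "a \<in> nf_carrier n \<Longrightarrow> b \<in> nf_carrier n \<Longrightarrow> nf_mult a b \<in> nf_carrier n"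
  unfolding nf_mult_def using nf_word_in_lists foldr_pc_act_in_nf_carrier by blast

lemma mult_nf_class:
  assumes "a \<in> nf_carrier n" "b \<in> nf_carrier n"
  shows "nf_class n a \<otimes>\<^bsub>polycyclic n\<^esub> nf_class n b = nf_class n (nf_mult a b)"
proof -
  have cong: "(nf_word a @ nf_word b, nf_word (nf_mult a b)) \<in> pres_cong (pc_sigma0 n) (pc_rels n)"
    unfolding nf_mult_def using assms nf_word_in_lists foldr_pc_act_cong by blast
  then have "pres_class (pc_sigma0 n) (pc_rels n) (nf_word a @ nf_word b) = nf_class n (nf_mult a b)"
    unfolding nf_class_def using pres_cong_words[OF cong] by (subst pres_class_eq_iff) auto
  then show ?thesis
    using assms nf_word_in_lists
    by (simp add: nf_class_def polycyclic_def mult_presented_monoid del: in_lists_conv_set)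
qed

lemma prim_conj_polycyclic:
  "prim_conj (polycyclic n) =
    {(nf_class n (nf_mult u v), nf_class n (nf_mult v u)) | u v.
      u \<in> nf_carrier n \<and> v \<in> nf_carrier n}" (is "_ = ?R")
proof
  show "prim_conj (polycyclic n) \<subseteq> ?R"
  proof clarify
    fix a b assume "(a, b) \<in> prim_conj (polycyclic n)"
    then obtain u v where "u \<in> nf_carrier n" "v \<in> nf_carrier n"
      "a = nf_class n u \<otimes>\<^bsub>polycyclic n\<^esub> nf_class n v"
      "b = nf_class n v \<otimes>\<^bsub>polycyclic n\<^esub> nf_class n u"
      unfolding prim_conj_def carrier_polycyclic by blast
    then show "\<exists>u v. (a, b) = (nf_class n (nf_mult u v), nf_class n (nf_mult v u))
        \<and> u \<in> nf_carrier n \<and> v \<in> nf_carrier n"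
      using mult_nf_class by blast
  qed
  show "?R \<subseteq> prim_conj (polycyclic n)"
  proof clarify
    fix u v assume uv: "u \<in> nf_carrier n" "v \<in> nf_carrier n"
    then have "(nf_class n u \<otimes>\<^bsub>polycyclic n\<^esub> nf_class n v,
        nf_class n v \<otimes>\<^bsub>polycyclic n\<^esub> nf_class n u) \<in> prim_conj (polycyclic n)"
      unfolding prim_conj_def carrier_polycyclic by blast
    then show "(nf_class n (nf_mult u v), nf_class n (nf_mult v u)) \<in> prim_conj (polycyclic n)"
      using uv by (simp add: mult_nf_class)
  qed
qed

section \<open>Product rules for normal forms\<close>

lemma nf_mult_None [simp]: "nf_mult None b = None" "nf_mult a None = None"
  by (auto simp: nf_mult_def)

text \<open>A product of nonzero elements is governed by its middle q^-1 r. It equals t here, t^-1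
  in \<open>nf_mult_append_left\<close>, and 0 in \<open>nf_mult_incomparable\<close>.\<close>

lemma nf_mult_append_right [simp]:
  "nf_mult (Some (p, q)) (Some (q @ t, s)) = Some (p @ t, s)"
proof -
  have "foldr pc_act (map InvGen (rev q)) (Some (q @ t, s)) = Some (t, s)"
    by (induction q) auto
  then show ?thesis by (simp add: nf_mult_def foldr_map_Gen)
qed

lemma nf_mult_append_left [simp]:
  "nf_mult (Some (p, r @ t)) (Some (r, s)) = Some (p, s @ t)"
proof -
  have "foldr pc_act (map InvGen (rev (r @ t))) (Some (r, s)) = Some ([], s @ t)"
    by (induction r) (auto simp: foldr_map_InvGen)
  then show ?thesis by (simp add: nf_mult_def foldr_map_Gen)
qed

lemma nf_mult_eq [simp]: "nf_mult (Some (p, q)) (Some (q, s)) = Some (p, s)"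
  using nf_mult_append_right[of p q "[]" s] by simp

lemma nf_mult_incomparable [simp]:
  assumes "a \<noteq> b"
  shows "nf_mult (Some (p, z @ a # q)) (Some (z @ b # r, s)) = None"
proof -
  have "foldr pc_act (map InvGen (rev (z @ a # q))) (Some (z @ b # r, s)) = None"
    by (induction z) (use assms in auto)
  then show ?thesis by (simp add: nf_mult_def)
qed

section \<open>Primary conjugacy of normal forms\<close>

fun strip_prefix :: "'a list \<Rightarrow> 'a list \<Rightarrow> 'a list \<times> 'a list" where
  "strip_prefix (x # xs) (y # ys) = (if x = y then strip_prefix xs ys else (x # xs, y # ys))"
| "strip_prefix xs ys = (xs, ys)"

lemma strip_prefix_Nil [simp]: "strip_prefix xs [] = (xs, [])" "strip_prefix [] xs = ([], xs)"
  by (cases xs; simp)+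

lemma strip_prefix_append [simp]: "strip_prefix (z @ xs) (z @ ys) = strip_prefix xs ys"
  by (induction z) auto

lemma strip_prefix_append_Nil [simp]:
  "strip_prefix (z @ xs) z = (xs, [])" "strip_prefix z (z @ ys) = ([], ys)"
  using strip_prefix_append[of z xs "[]"] strip_prefix_append[of z "[]" ys] by simp_all

lemma strip_prefixE:
  assumes "strip_prefix xs ys = (\<alpha>, \<beta>)"
  obtains z where "xs = z @ \<alpha>" "ys = z @ \<beta>"
proof -
  have "\<exists>z. xs = z @ \<alpha> \<and> ys = z @ \<beta>"
    using assms
  proof (induction xs ys rule: strip_prefix.induct)
    case (1 x xs y ys)
    then show ?case
      by (cases "x = y") (auto intro: exI[of _ "y # _"])
  qed auto
  then show ?thesis using that by blast
qed

text \<open>The three cases match the three product rules; equal words fall under both of the first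
  two.\<close>

lemma list_comparable_cases:
  fixes xs ys :: "'a list"
  obtains (left) t where "ys = xs @ t" | (right) t where "xs = ys @ t"
  | (incomparable) z a b xs' ys' where "a \<noteq> b" "xs = z @ a # xs'" "ys = z @ b # ys'"
proof (induction xs arbitrary: ys thesis)
  case Nil
  then show ?case by simp
next
  case (Cons x xs)
  show ?case
  proof (cases ys)
    case Nil
    then show ?thesis using Cons.prems(2) by simp
  next
    case ys: (Cons y ys')
    show ?thesis
    proof (cases "x = y")
      case False
      then show ?thesis using Cons.prems(3)[of x y "[]"] ys by simp
    next
      case True
      show ?thesis
      proof (rule Cons.IH[of ys'])
        show ?thesis if "ys' = xs @ t" for t
          using that Cons.prems(1)[of t] ys True by simp
        show ?thesis if "xs = ys' @ t" for t
          using that Cons.prems(2)[of t] ys True by simp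
        show ?thesis if "a \<noteq> b" "xs = z @ a # us" "ys' = z @ b # vs" for z a b us vs
          using that Cons.prems(3)[of a b "x # z" us vs] ys True by simp
      qed
    qed
  qed
qed

definition rotated :: "'a list \<Rightarrow> 'a list \<Rightarrow> bool" where
  "rotated x y \<longleftrightarrow> (\<exists>k. y = rotate k x)"

text \<open>The two descriptions divide the work: powers of \<open>rotate\<close> compose, which
  yields transitivity, while the factorization supplies the conjugating factors.\<close>

lemma rotated_iff: "rotated x y \<longleftrightarrow> (\<exists>g h. x = g @ h \<and> y = h @ g)"
proof
  assume "rotated x y"
  then obtain k where "y = drop k x @ take k x"
    unfolding rotated_def rotate_drop_take by blast
  then show "\<exists>g h. x = g @ h \<and> y = h @ g" by (metis append_take_drop_id)
next
  assume "\<exists>g h. x = g @ h \<and> y = h @ g"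
  then show "rotated x y" unfolding rotated_def by (metis rotate_append)
qed

lemma rotated_append [simp]: "rotated (g @ h) (h @ g)"
  by (auto simp: rotated_iff)

lemma rotated_trans: "rotated x y \<Longrightarrow> rotated y z \<Longrightarrow> rotated x z"
  by (auto simp: rotated_def rotate_rotate)

lemma rotated_Nil [simp]: "rotated [] x \<longleftrightarrow> x = []" "rotated x [] \<longleftrightarrow> x = []"
  by (auto simp: rotated_iff)

section \<open>The conjugacy criterion on normal forms\<close>

fun stripped_conj :: "'a list \<times> 'a list \<Rightarrow> 'a list \<times> 'a list \<Rightarrow> bool" where
  "stripped_conj (\<alpha>, \<beta>) (\<alpha>', \<beta>') \<longleftrightarrow> \<alpha> = \<alpha>' \<and> \<beta> = \<beta>'
    \<or> \<beta> = [] \<and> \<beta>' = [] \<and> rotated \<alpha> \<alpha>' \<or> \<alpha> = [] \<and> \<alpha>' = [] \<and> rotated \<beta> \<beta>'"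

lemma stripped_conj_refl [simp]: "stripped_conj a a"
  by (cases a) auto

lemma stripped_conj_trans: "stripped_conj a b \<Longrightarrow> stripped_conj b c \<Longrightarrow> stripped_conj a c"
  by (cases a; cases b; cases c) (auto intro: rotated_trans)

text \<open>A rotation alternative would force an empty component on both sides, so only equality of
  the pairs remains.\<close>

lemma stripped_conj_nonempty:
  "stripped_conj a b \<Longrightarrow> fst a \<noteq> [] \<and> snd a \<noteq> [] \<Longrightarrow> b = a"
  "stripped_conj a b \<Longrightarrow> fst b \<noteq> [] \<and> snd b \<noteq> [] \<Longrightarrow> b = a"
  by (cases a; cases b; auto)+

fun nf_conj :: "pc_nf \<Rightarrow> pc_nf \<Rightarrow> bool" where
  "nf_conj None None \<longleftrightarrow> True"
| "nf_conj None (Some (x, y)) \<longleftrightarrow> fst (strip_prefix x y) \<noteq> [] \<and> snd (strip_prefix x y) \<noteq> []"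
| "nf_conj (Some (x, y)) None \<longleftrightarrow> fst (strip_prefix x y) \<noteq> [] \<and> snd (strip_prefix x y) \<noteq> []"
| "nf_conj (Some (x, y)) (Some (x', y')) \<longleftrightarrow> stripped_conj (strip_prefix x y) (strip_prefix x' y')"

text \<open>If one end is 0, the pair of \<open>b\<close> has two nonempty components; the other end
  is then 0 or has the same pair. A middle element 0 would link all elements with such pairs,
  however different.\<close>

lemma nf_conj_trans:
  assumes "nf_conj a b" "nf_conj b c" "b \<noteq> None"
  shows "nf_conj a c"
proof -
  obtain x y where b: "b = Some (x, y)" using assms(3) by auto
  consider "a = None" "c = None" | x' y' where "a = None" "c = Some (x', y')"
    | x' y' where "a = Some (x', y')" "c = None"
    | x' y' x'' y'' where "a = Some (x', y')" "c = Some (x'', y'')"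
    by (cases a; cases c) auto
  then show ?thesis
  proof cases
    case 1
    then show ?thesis by simp
  next
    case (2 x' y')
    then show ?thesis
      using assms b stripped_conj_nonempty(1)[of "strip_prefix x y" "strip_prefix x' y'"] by simp
  next
    case (3 x' y')
    then show ?thesis
      using assms b stripped_conj_nonempty(2)[of "strip_prefix x' y'" "strip_prefix x y"] by simp
  next
    case 4
    then show ?thesis using assms b stripped_conj_trans by simp blast
  qed
qed

text \<open>The product uv depends on comparing q with r, and vu on comparing s with p. Prefix
  relations in the same direction (left-left, right-right) give rotations, opposite ones give equal
  pairs. If exactly one comparison diverges, one product is 0 and the divergence makes both
  components of the other pair nonempty.\<close>

lemma nf_conj_nf_mult: "nf_conj (nf_mult u v) (nf_mult v u)"
proof (cases "u = None \<or> v = None")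
  case True
  then show ?thesis by auto
next
  case False
  then obtain p q r s where uv: "u = Some (p, q)" "v = Some (r, s)" by auto
  show ?thesis
  proof (cases q r rule: list_comparable_cases)
    case 1: left
    show ?thesis
      by (cases s p rule: list_comparable_cases) (use 1 uv in auto)
  next
    case 2: right
    show ?thesis
      by (cases s p rule: list_comparable_cases) (use 2 uv in auto)
  next
    case 3: incomparable
    show ?thesis
      by (cases s p rule: list_comparable_cases) (use 3 uv in auto)
  qed
qed

lemma nf_conj_imp_nf_mult:
  assumes "nf_conj a b" "a \<in> nf_carrier n" "b \<in> nf_carrier n"
  shows "\<exists>u \<in> nf_carrier n. \<exists>v \<in> nf_carrier n. a = nf_mult u v \<and> b = nf_mult v u"
proof -
  \<comment> \<open>The factors are x and y^-1. In the order y^-1 x they give 0, because x and y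
    diverge after their common prefix.\<close>
  have split: "\<exists>u \<in> nf_carrier n. \<exists>v \<in> nf_carrier n. None = nf_mult u v \<and> Some (x, y) = nf_mult v u"
    if "nf_conj None (Some (x, y))" "Some (x, y) \<in> nf_carrier n" for x y
  proof (intro bexI conjI)
    show "None = nf_mult (Some ([], y)) (Some (x, []))"
      by (cases y x rule: list_comparable_cases) (use that(1) in auto)
    show "Some (x, y) = nf_mult (Some (x, [])) (Some ([], y))" by simp
  qed (use that(2) in auto)
  consider "a = None" "b = None" | x y where "a = None" "b = Some (x, y)"
    | x y where "a = Some (x, y)" "b = None"
    | x y x' y' where "a = Some (x, y)" "b = Some (x', y')"
    by (cases a; cases b) auto
  then show ?thesis
  proof cases
    case 1
    then show ?thesis by (metis None_in_nf_carrier nf_mult_None(1))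
  next
    case 2
    then show ?thesis using split assms by blast
  next
    case 3
    then have "nf_conj None (Some (x, y))" using assms by simp
    then show ?thesis using split 3 assms by blast
  next
    case 4
    obtain \<alpha> \<beta> \<alpha>' \<beta>' where st: "strip_prefix x y = (\<alpha>, \<beta>)" "strip_prefix x' y' = (\<alpha>', \<beta>')"
      by (metis surj_pair)
    from st obtain z z' where z: "x = z @ \<alpha>" "y = z @ \<beta>" "x' = z' @ \<alpha>'" "y' = z' @ \<beta>'"
      by (metis strip_prefixE)
    have "stripped_conj (\<alpha>, \<beta>) (\<alpha>', \<beta>')" using assms 4 st by simp
    then consider "\<alpha> = \<alpha>'" "\<beta> = \<beta>'"
      | g h where "\<beta> = []" "\<beta>' = []" "\<alpha> = g @ h" "\<alpha>' = h @ g"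
      | g h where "\<alpha> = []" "\<alpha>' = []" "\<beta> = g @ h" "\<beta>' = h @ g"
      by (auto simp: rotated_iff)
    then show ?thesis
    proof cases
      case 1
      \<comment> \<open>With u = z z'^-1, the inner z' cancels in uv, and vu exchanges the common
        prefix z for z'.\<close>
      show ?thesis
        by (rule bexI[of _ "Some (z, z')"], rule bexI[of _ "Some (z' @ \<alpha>, z @ \<beta>)"])
          (use assms 1 4 z in auto)
    next
      case 2
      \<comment> \<open>The factors z g z'^-1 and z' h z^-1 meet in z' in one order and in z in the
        other, leaving z g h z^-1 and z' h g z'^-1.\<close>
      have "a = nf_mult (Some (z @ g, z')) (Some (z' @ h, z))"
        "b = nf_mult (Some (z' @ h, z)) (Some (z @ g, z'))"
        using 2 4 z by simp_all
      moreover have "Some (z @ g, z') \<in> nf_carrier n" "Some (z' @ h, z) \<in> nf_carrier n"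
        using assms 2 4 z by simp_all
      ultimately show ?thesis by blast
    next
      case 3
      \<comment> \<open>The mirror image of the previous case: the parts g and h of the rotated word
        now sit in the inverse components.\<close>
      have "a = nf_mult (Some (z, z' @ h)) (Some (z', z @ g))"
        "b = nf_mult (Some (z', z @ g)) (Some (z, z' @ h))"
        using 3 4 z by simp_all
      moreover have "Some (z, z' @ h) \<in> nf_carrier n" "Some (z', z @ g) \<in> nf_carrier n"
        using assms 3 4 z by simp_all
      ultimately show ?thesis by blast
    qed
  qed
qed

lemma prim_conj_iff_nf_conj:
  assumes "a \<in> nf_carrier n" "b \<in> nf_carrier n"
  shows "(nf_class n a, nf_class n b) \<in> prim_conj (polycyclic n) \<longleftrightarrow> nf_conj a b"
proof
  assume "(nf_class n a, nf_class n b) \<in> prim_conj (polycyclic n)"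
  then obtain u v where uv: "u \<in> nf_carrier n" "v \<in> nf_carrier n"
    "nf_class n a = nf_class n (nf_mult u v)" "nf_class n b = nf_class n (nf_mult v u)"
    unfolding prim_conj_polycyclic by auto
  then have "a = nf_mult u v" "b = nf_mult v u"
    using assms inj_on_nf_class nf_mult_in_nf_carrier by (meson inj_onD)+
  then show "nf_conj a b" by (simp add: nf_conj_nf_mult)
next
  assume "nf_conj a b"
  then show "(nf_class n a, nf_class n b) \<in> prim_conj (polycyclic n)"
    using nf_conj_imp_nf_mult[OF _ assms] unfolding prim_conj_polycyclic by blast
qed

section \<open>Primary conjugacy in the polycyclic monoid\<close>

lemma prim_conj_subset: "monoid M \<Longrightarrow> prim_conj M \<subseteq> carrier M \<times> carrier M"
  by (auto simp: prim_conj_def monoid.m_closed)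

lemma prim_conj_refl:
  assumes "monoid M" "a \<in> carrier M"
  shows "(a, a) \<in> prim_conj M"
proof -
  have "(a \<otimes>\<^bsub>M\<^esub> \<one>\<^bsub>M\<^esub>, \<one>\<^bsub>M\<^esub> \<otimes>\<^bsub>M\<^esub> a) \<in> prim_conj M"
    unfolding prim_conj_def using assms monoid.one_closed by blast
  then show ?thesis using assms by (simp add: monoid.l_one monoid.r_one)
qed

lemma nf_class_None: "nf_class n None = pc_zero n"
  by (simp add: nf_class_def pc_zero_def)

lemma prim_conj_polycyclic_trans:
  assumes "(a, b) \<in> prim_conj (polycyclic n)" "(b, c) \<in> prim_conj (polycyclic n)"
    and "b \<noteq> pc_zero n"
  shows "(a, c) \<in> prim_conj (polycyclic n)"
proof -
  have "monoid (polycyclic n)" by (simp add: polycyclic_def monoid_presented_monoid)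
  then have "a \<in> carrier (polycyclic n)" "b \<in> carrier (polycyclic n)" "c \<in> carrier (polycyclic n)"
    using assms prim_conj_subset by blast+
  then obtain a' b' c' where *: "a' \<in> nf_carrier n" "b' \<in> nf_carrier n" "c' \<in> nf_carrier n"
    "a = nf_class n a'" "b = nf_class n b'" "c = nf_class n c'"
    unfolding carrier_polycyclic by blast
  have "b' \<noteq> None"
    using assms(3) *(5) nf_class_None by metis
  then show ?thesis
    using assms(1,2) * nf_conj_trans[of a' b' c'] by (simp add: prim_conj_iff_nf_conj)
qed

text \<open>In a chain \<open>x, y, z, w\<close> one of \<open>y, z\<close> can be skipped unless \<open>y = z = e\<close>, and then
  \<open>x, e, w\<close> is a chain.\<close>

lemma relcomp_eq_trancl:
  assumes refl: "\<And>x y. (x, y) \<in> r \<Longrightarrow> (y, y) \<in> r"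
    and trans: "\<And>x y z. (x, y) \<in> r \<Longrightarrow> (y, z) \<in> r \<Longrightarrow> y \<noteq> e \<Longrightarrow> (x, z) \<in> r"
  shows "r O r = r\<^sup>+"
proof
  show "r O r \<subseteq> r\<^sup>+" by auto
  show "r\<^sup>+ \<subseteq> r O r"
  proof (rule subrelI)
    fix x y assume "(x, y) \<in> r\<^sup>+"
    then show "(x, y) \<in> r O r"
    proof (induction rule: trancl_induct)
      case (base y)
      \<comment> \<open>A single step is padded by the loop at its end point.\<close>
      then show ?case using refl by blast
    next
      case (step y w)
      then obtain m where m: "(x, m) \<in> r" "(m, y) \<in> r" by blast
      show ?case
      proof (cases "m = y")
        case True
        then show ?thesis using m step.hyps by blast
      next
        case False
        then have "(x, y) \<in> r \<or> (m, w) \<in> r"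
          using trans[of x m y] trans[of m y w] m step.hyps by blast
        then show ?thesis using m step.hyps by blast
      qed
    qed
  qed
qed

theorem theorem3p7:
  fixes n :: nat
  assumes "n \<ge> 2"
  shows "(\<forall>a \<in> carrier (polycyclic n). \<forall>b \<in> carrier (polycyclic n). \<forall>c \<in> carrier (polycyclic n).
            b \<noteq> pc_zero n \<longrightarrow> (a, b) \<in> prim_conj (polycyclic n) \<longrightarrow> (b, c) \<in> prim_conj (polycyclic n)
            \<longrightarrow> (a, c) \<in> prim_conj (polycyclic n))
       \<and> prim_conj (polycyclic n) O prim_conj (polycyclic n) = (prim_conj (polycyclic n))\<^sup>+"
proof (intro conjI ballI impI)
  show "(a, c) \<in> prim_conj (polycyclic n)"
    if "(a, b) \<in> prim_conj (polycyclic n)" "(b, c) \<in> prim_conj (polycyclic n)"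
      "b \<noteq> pc_zero n" for a b c
    using that by (rule prim_conj_polycyclic_trans)
  have mon: "monoid (polycyclic n)" by (simp add: polycyclic_def monoid_presented_monoid)
  show "prim_conj (polycyclic n) O prim_conj (polycyclic n) = (prim_conj (polycyclic n))\<^sup>+"
  \<comment> \<open>The exceptional element \<open>e\<close> becomes \<open>pc_zero n\<close>; loops
    exist because each element factors as itself times 1.\<close>
  proof (rule relcomp_eq_trancl)
    fix a b assume "(a, b) \<in> prim_conj (polycyclic n)"
    then show "(b, b) \<in> prim_conj (polycyclic n)"
      using prim_conj_subset[OF mon] prim_conj_refl[OF mon] by blast
  qed (rule prim_conj_polycyclic_trans)
qed

end
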